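(* Let $N\geq1$, $T>0$ and $A_N=-i\operatorname{diag}(1^2,2^2,\ldots,N^2)\in\mathbb{C}^{N\times N}$. Scalar recovery is exact at horizon $T$, i.e. $\max_{b\in\mathbb{C}^N,\ \Vert b\Vert=1}\lambda_{\min}(G_T^{\mathbb{C}}(A_N,b))$ equals the relaxed value, if and only if $$e^{-ij^2T}=e^{-ik^2T}\qquad\forall j,k\in\{1,\ldots,N\}.$$ Equivalently: every $T>0$ is a recovery horizon when $N=1$; the recovery horizons are $T\in(2\pi/3)\mathbb{N}^*$ when $N=2$, and $T\in2\pi\mathbb{N}^*$ when $N\geq3$. At every recovery horizon, the maximizing unit profiles $b_N=(b_{N,1},\ldots,b_{N,N})\in\mathbb{C}^N$ are exactly those satisfying $$\vert b_{N,j}\vert^2=\frac1N\qquad\forall j\in\{1,\ldots,N\}$$ (so their squared moduli are unique while their phases are arbitrary), and they satisfy $G_T^{\mathbb{C}}(A_N,b_N)=\frac TN\mathrm{Id}$. After multiplication by $\sqrt N$ their modal moduli are constant; the corresponding formal infinite profiles $b=\sum_{j\geq1}b_j\varphi_j$ with $\vert b_j\vert=1$ for all $j$ belong to $H_D^{-s}$ exactly when $s>1/2$.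
   Context: $G_T^{\mathbb{C}}(A_N,b)=\int_0^Te^{tA_N}bb^*e^{tA_N^*}\,dt$ is the Hermitian Gramian, where $^*$ is the adjoint. The relaxed value is $\max\{\lambda_{\min}(\int_0^Te^{tA_N}Xe^{tA_N^*}dt)\mid X\in\mathbb{C}^{N\times N}\text{ Hermitian},\ X\succeq0,\ \operatorname{tr}X=1\}$; since the flow is unitary it equals $T/N$. $\mathbb{N}^*=\{1,2,\ldots\}$. $\varphi_j(x)=\sqrt{2/\pi}\sin(jx)$ on $(0,\pi)$; for a formal series $b=\sum_{j\geq1}b_j\varphi_j$ and $s\in\mathbb{R}$, $b\in H_D^{-s}$ means $\sum_{j\geq1}j^{-2s}\vert b_j\vert^2<+\infty$. *)

theory Defs
  imports
    "HOL-Analysis.Henstock_Kurzweil_Integration"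
    "HOL-Analysis.Infinite_Sum"
    "Jordan_Normal_Form.Spectral_Radius"
    "Jordan_Normal_Form.Schur_Decomposition"
begin

text \<open>Vectors and matrices have 0-based entries, so the mode \<open>j \<in> {1..N}\<close> of a vector \<open>b\<close> is
  \<open>b $ (j - 1)\<close>. The adjoint is the library's conjugate transpose \<^const>\<open>mat_adjoint\<close>.\<close>

definition cvec_norm :: "complex vec \<Rightarrow> real" where
  "cvec_norm v = sqrt (Re (v \<bullet>c v))"

definition mat_trace :: "complex mat \<Rightarrow> complex" where
  "mat_trace X = (\<Sum>i<dim_row X. X $$ (i, i))"

definition hermitian_mat :: "complex mat \<Rightarrow> bool" where
  "hermitian_mat X \<longleftrightarrow> mat_adjoint X = X"

text \<open>Used only for Hermitian \<open>X\<close>, where the quadratic form is real.\<close>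

definition psd_mat :: "complex mat \<Rightarrow> bool" where
  "psd_mat X \<longleftrightarrow> (\<forall>v \<in> carrier_vec (dim_row X). 0 \<le> Re ((X *\<^sub>v v) \<bullet>c v))"

definition mat_exp :: "complex mat \<Rightarrow> complex mat" where
  "mat_exp A = mat (dim_row A) (dim_row A) (\<lambda>(i, j). \<Sum>k. (A ^\<^sub>m k) $$ (i, j) / fact k)"

text \<open>The smallest eigenvalue of a Hermitian matrix; the spectrum is then real, and \<open>Re\<close> only
  changes its type.\<close>

definition lambda_min :: "complex mat \<Rightarrow> real" where
  "lambda_min M = Min (Re ` spectrum M)"

text \<open>\<open>gramian_op A T X\<close> is \<open>\<integral>\<^sub>0\<^sup>T e\<^bsup>tA\<^esup> X e\<^bsup>tA*\<^esup> dt\<close>, integrated entrywise.\<close>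

definition gramian_op :: "complex mat \<Rightarrow> real \<Rightarrow> complex mat \<Rightarrow> complex mat" where
  "gramian_op A T X = mat (dim_row A) (dim_row A) (\<lambda>(i, j).
     integral {0..T} (\<lambda>t.
       (mat_exp (complex_of_real t \<cdot>\<^sub>m A) * X * mat_exp (complex_of_real t \<cdot>\<^sub>m mat_adjoint A))
         $$ (i, j)))"

definition rank_one :: "complex vec \<Rightarrow> complex mat" where
  "rank_one b = (let B = mat_of_cols (dim_vec b) [b] in B * mat_adjoint B)"

definition gramian :: "complex mat \<Rightarrow> real \<Rightarrow> complex vec \<Rightarrow> complex mat" where
  "gramian A T b = gramian_op A T (rank_one b)"

definition unit_profiles :: "nat \<Rightarrow> complex vec set" where
  "unit_profiles n = {b \<in> carrier_vec n. cvec_norm b = 1}"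

definition relaxed_profiles :: "nat \<Rightarrow> complex mat set" where
  "relaxed_profiles n =
     {X \<in> carrier_mat n n. hermitian_mat X \<and> psd_mat X \<and> mat_trace X = 1}"

definition scalar_values :: "complex mat \<Rightarrow> real \<Rightarrow> real set" where
  "scalar_values A T = (\<lambda>b. lambda_min (gramian A T b)) ` unit_profiles (dim_row A)"

definition relaxed_values :: "complex mat \<Rightarrow> real \<Rightarrow> real set" where
  "relaxed_values A T = (\<lambda>X. lambda_min (gramian_op A T X)) ` relaxed_profiles (dim_row A)"

text \<open>\<^const>\<open>Greatest\<close> is unspecified on a set without a greatest element. The existence of both
  maxima is therefore asserted separately where they are used.\<close>

definition scalar_value :: "complex mat \<Rightarrow> real \<Rightarrow> real" where
  "scalar_value A T = (GREATEST v. v \<in> scalar_values A T)"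

definition relaxed_value :: "complex mat \<Rightarrow> real \<Rightarrow> real" where
  "relaxed_value A T = (GREATEST v. v \<in> relaxed_values A T)"

definition has_max :: "real set \<Rightarrow> bool" where
  "has_max S \<longleftrightarrow> (\<exists>m \<in> S. \<forall>v \<in> S. v \<le> m)"

definition scalar_recovery_exact :: "complex mat \<Rightarrow> real \<Rightarrow> bool" where
  "scalar_recovery_exact A T \<longleftrightarrow> scalar_value A T = relaxed_value A T"

definition recovery_horizons :: "complex mat \<Rightarrow> real set" where
  "recovery_horizons A = {T. 0 < T \<and> scalar_recovery_exact A T}"

definition maximizing_profiles :: "complex mat \<Rightarrow> real \<Rightarrow> complex vec set" where
  "maximizing_profiles A T =
     {b \<in> unit_profiles (dim_row A). lambda_min (gramian A T b) = scalar_value A T}"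

definition schroedinger_mat :: "nat \<Rightarrow> complex mat" where
  "schroedinger_mat N = mat_diag N (\<lambda>j. - \<i> * (of_nat (Suc j))\<^sup>2)"

text \<open>A formal series \<open>\<Sum>\<^bsub>j\<ge>1\<^esub> b\<^sub>j \<phi>\<^sub>j\<close> in the sine modes
  \<open>\<phi>\<^sub>j(x) = sqrt (2/\<pi>) sin (j x)\<close> on \<open>(0, \<pi>)\<close> is its sequence of coefficients; the entry at
  index 0 is ignored. \<open>HD_neg s\<close> is the space \<open>H\<^sub>D\<^bsup>-s\<^esup>\<close>.\<close>

definition HD_neg :: "real \<Rightarrow> (nat \<Rightarrow> complex) set" where
  "HD_neg s = {b. (\<lambda>j. real j powr (- 2 * s) * (cmod (b j))\<^sup>2) summable_on {1..}}"

end

theory Submission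
  imports
    Defs
    "HOL-Analysis.Function_Topology"
    "HOL-Analysis.Summation_Tests"
    "HOL-Analysis.Complex_Transcendental"
begin

text \<open>
  The smallest eigenvalue \<open>c\<close> of a Hermitian matrix \<open>M\<close> is the minimum of its quadratic form on
  the unit sphere. In particular no diagonal entry is below \<open>c\<close>, so \<open>n c\<close> is at most the trace;
  in case of equality \<open>M - c\<close> is positive semidefinite with zero diagonal, and \<open>M = c\<close>.
  The flow of a diagonal skew-adjoint generator is unitary, so the Gramian of any profile of
  trace one has trace \<open>T\<close>. Hence \<open>T/n\<close> bounds all values, and a unit profile \<open>b\<close> reaches it
  iff its Gramian, with entries \<open>b\<^sub>i b\<^sub>j\<^sup>* \<integral>\<^sub>0\<^sup>T e\<^bsup>-i(w\<^sub>i - w\<^sub>j)t\<^esup> dt\<close>, is \<open>T/n\<close> times the identity: the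
  diagonal forces equal moduli, and then the oscillatory integrals must vanish.
\<close>

section \<open>Sesquilinear forms and the complex unit sphere\<close>

definition sesq_form :: "nat \<Rightarrow> (nat \<Rightarrow> nat \<Rightarrow> complex) \<Rightarrow> (nat \<Rightarrow> complex) \<Rightarrow> (nat \<Rightarrow> complex) \<Rightarrow> complex" where
  "sesq_form n m f g = (\<Sum>i<n. (\<Sum>j<n. m i j * f j) * cnj (g i))"

text \<open>Coordinate functions are used in place of \<open>complex vec\<close> because the
  function type carries the product topology. Vanishing at all indices from \<open>n\<close> on
  makes the set compact and gives each unit profile exactly one representative.\<close>

definition unit_csphere :: "nat \<Rightarrow> (nat \<Rightarrow> complex) set" where
  "unit_csphere n = {f. (\<forall>i\<ge>n. f i = 0) \<and> (\<Sum>i<n. (cmod (f i))\<^sup>2) = 1}"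

lemma sesq_form_add_left: "sesq_form n m (\<lambda>i. f i + g i) h = sesq_form n m f h + sesq_form n m g h"
  by (simp add: sesq_form_def ring_distribs sum.distrib)

lemma sesq_form_add_right: "sesq_form n m f (\<lambda>i. g i + h i) = sesq_form n m f g + sesq_form n m f h"
  by (simp add: sesq_form_def ring_distribs sum.distrib)

lemma sesq_form_scale_left: "sesq_form n m (\<lambda>i. c * f i) g = c * sesq_form n m f g"
  by (simp add: sesq_form_def sum_distrib_left mult_ac)

lemma sesq_form_scale_right: "sesq_form n m f (\<lambda>i. c * g i) = cnj c * sesq_form n m f g"
  by (simp add: sesq_form_def sum_distrib_left mult_ac)

text \<open>Subtracting a real multiple \<open>c\<close> of the identity turns a lower bound
  \<open>c\<close> for the form on the sphere into semidefiniteness, as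
  \<open>psd_sesq_form_kernel\<close> requires.\<close>

lemma sesq_form_diff_scalar:
  "sesq_form n (\<lambda>i j. m i j - (if i = j then c else 0)) f f
     = sesq_form n m f f - c * of_real (\<Sum>i<n. (cmod (f i))\<^sup>2)"
proof -
  have "(\<Sum>j<n. (m i j - (if i = j then c else 0)) * f j) = (\<Sum>j<n. m i j * f j) - c * f i"
    if "i < n" for i
  proof -
    have "(\<Sum>j<n. (if i = j then c else 0) * f j) = (\<Sum>j<n. if j = i then c * f j else 0)"
      by (intro sum.cong) auto
    also have "\<dots> = c * f i"
      using that by simp
    finally show ?thesis
      by (simp add: left_diff_distrib sum_subtractf)
  qed
  then have "sesq_form n (\<lambda>i j. m i j - (if i = j then c else 0)) f f
      = (\<Sum>i<n. ((\<Sum>j<n. m i j * f j) - c * f i) * cnj (f i))"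
    unfolding sesq_form_def by (intro sum.cong) auto
  also have "\<dots> = sesq_form n m f f - (\<Sum>i<n. c * of_real ((cmod (f i))\<^sup>2))"
    by (simp add: sesq_form_def left_diff_distrib sum_subtractf mult.assoc complex_norm_square
        del: of_real_power)
  finally show ?thesis
    by (simp add: sum_distrib_left)
qed

lemma sesq_form_hermitian:
  assumes "\<And>i j. i < n \<Longrightarrow> j < n \<Longrightarrow> m i j = cnj (m j i)"
  shows "sesq_form n m g f = cnj (sesq_form n m f g)"
proof -
  have "sesq_form n m g f = (\<Sum>i<n. \<Sum>j<n. cnj (m j i) * g j * cnj (f i))"
    unfolding sesq_form_def sum_distrib_right
    by (intro sum.cong refl) (subst assms, auto)
  also have "\<dots> = (\<Sum>j<n. \<Sum>i<n. cnj (m j i) * g j * cnj (f i))"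
    by (rule sum.swap)
  also have "\<dots> = cnj (sesq_form n m f g)"
    by (simp add: sesq_form_def sum_distrib_right sum_distrib_left mult_ac)
  finally show ?thesis .
qed

text \<open>The first variation of a semidefinite form vanishes at its zeros.\<close>

lemma psd_sesq_form_kernel:
  assumes herm: "\<And>i j. i < n \<Longrightarrow> j < n \<Longrightarrow> m i j = cnj (m j i)"
    and psd: "\<And>f. 0 \<le> Re (sesq_form n m f f)"
    and zero: "Re (sesq_form n m f f) = 0"
    and i: "i < n"
  shows "(\<Sum>j<n. m i j * f j) = 0"
proof -
  \<comment> \<open>The form is varied from \<open>f\<close> in the direction of its own image
    \<open>g\<close>. The linear term of the variation is then \<open>2 * t * s\<close>, with
    \<open>s\<close> the squared norm of \<open>g\<close>, and the claim reduces to
    \<open>s = 0\<close>.\<close>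
  define g where "g i = (\<Sum>j<n. m i j * f j)" for i
  define s where "s = (\<Sum>i<n. (cmod (g i))\<^sup>2)"
  define q where "q = Re (sesq_form n m g g)"
  have s0: "s \<ge> 0"
    unfolding s_def by (intro sum_nonneg) auto
  have q0: "q \<ge> 0"
    unfolding q_def by (rule psd)
  have fg: "sesq_form n m f g = of_real s"
    by (simp add: sesq_form_def s_def complex_norm_square flip: g_def del: of_real_power)
  have gf: "sesq_form n m g f = of_real s"
    by (subst sesq_form_hermitian[OF herm]) (simp_all add: fg)
  have "0 \<le> 2 * t * s + t\<^sup>2 * q" for t :: real
  proof -
    have "0 \<le> Re (sesq_form n m (\<lambda>i. f i + of_real t * g i) (\<lambda>i. f i + of_real t * g i))"
      by (rule psd)
    also have "\<dots> = 2 * t * s + t\<^sup>2 * q"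
      by (simp add: sesq_form_add_left sesq_form_add_right sesq_form_scale_left sesq_form_scale_right fg gf zero
          q_def power2_eq_square)
    finally show ?thesis .
  qed
  note quad = this
  \<comment> \<open>This \<open>t\<close> minimizes \<open>2 * t * s + t\<^sup>2 * (q + 1)\<close>;
    taking \<open>q + 1\<close> instead of \<open>q\<close> keeps the denominator positive.\<close>
  define t where "t = - s / (q + 1)"
  have td: "t * (q + 1) = - s"
    using q0 by (simp add: t_def)
  have "0 \<le> (2 * t * s + t\<^sup>2 * q) * (q + 1)\<^sup>2"
    using quad by (intro mult_nonneg_nonneg) auto
  also have "\<dots> = 2 * (t * (q + 1)) * s * (q + 1) + (t * (q + 1))\<^sup>2 * q"
    by (simp add: power2_eq_square algebra_simps)
  also have "\<dots> = - (s\<^sup>2 * (q + 2))"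
    unfolding td by (simp add: power2_eq_square algebra_simps)
  finally have "s\<^sup>2 * (q + 2) \<le> 0" by simp
  with q0 have "s = 0"
    by (simp add: mult_le_0_iff)
  then have "(cmod (g i))\<^sup>2 = 0"
    using i unfolding s_def by (subst (asm) sum_nonneg_eq_0_iff) auto
  then show ?thesis
    by (simp add: g_def)
qed

text \<open>The sphere is a closed subset of a product of compact sets, so Tychonoff's theorem
  applies.\<close>

lemma compact_unit_csphere: "compact (unit_csphere n)"
proof -
  \<comment> \<open>The factors \<open>{0}\<close> encode vanishing from index \<open>n\<close> on.
    Below \<open>n\<close> closed unit discs suffice, since no coordinate of a unit vector has
    modulus above 1.\<close>
  let ?B = "\<lambda>i. if i < n then cball 0 1 else {0 :: complex}"
  let ?K = "PiE UNIV ?B"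
  have "compactin (product_topology (\<lambda>i. euclidean) UNIV) ?K"
    by (subst compactin_PiE) auto
  then have K: "compact ?K"
    by (simp add: euclidean_product_topology)
  have "continuous_on UNIV (\<lambda>f :: nat \<Rightarrow> complex. \<Sum>i<n. (cmod (f i))\<^sup>2)"
    by (intro continuous_intros continuous_on_product_coordinates)
  then have "closed ((\<lambda>f :: nat \<Rightarrow> complex. \<Sum>i<n. (cmod (f i))\<^sup>2) -` {1})"
    by (rule closed_vimage[OF closed_singleton])
  then have "compact (?K \<inter> (\<lambda>f. \<Sum>i<n. (cmod (f i))\<^sup>2) -` {1})"
    by (rule compact_Int_closed[OF K])
  also have "?K \<inter> (\<lambda>f. \<Sum>i<n. (cmod (f i))\<^sup>2) -` {1} = unit_csphere n"
  proof -
    have "cmod (f i) \<le> 1" if "(\<Sum>i<n. (cmod (f i))\<^sup>2) = 1" "i < n" for f :: "nat \<Rightarrow> complex" and i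
    proof -
      have "(cmod (f i))\<^sup>2 \<le> (\<Sum>i<n. (cmod (f i))\<^sup>2)"
        using that by (intro member_le_sum) auto
      then show ?thesis
        using that by (simp add: power_le_one_iff abs_square_le_1)
    qed
    then show ?thesis
      by (auto simp: unit_csphere_def PiE_def Pi_def split: if_splits)
  qed
  finally show ?thesis .
qed

lemma unit_csphere_nonempty: "n > 0 \<Longrightarrow> unit_csphere n \<noteq> {}"
proof -
  assume "n > 0"
  have "(\<Sum>i<n. (cmod (if i = 0 then 1 else 0))\<^sup>2) = (\<Sum>i<n. if i = 0 then 1 else 0 :: real)"
    by (intro sum.cong) auto
  with \<open>n > 0\<close> have "(\<lambda>i. if i = 0 then 1 else 0) \<in> unit_csphere n"
    by (simp add: unit_csphere_def)
  then show ?thesis by blast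
qed

text \<open>Both sides are homogeneous of degree two, so the bound passes from the sphere to every
  \<open>f\<close> by rescaling. If the norm is zero, both sides vanish.\<close>

lemma sesq_form_normalize:
  assumes lb: "\<And>f. f \<in> unit_csphere n \<Longrightarrow> c \<le> Re (sesq_form n m f f)"
  shows "c * (\<Sum>i<n. (cmod (f i))\<^sup>2) \<le> Re (sesq_form n m f f)"
proof -
  define s where "s = (\<Sum>i<n. (cmod (f i))\<^sup>2)"
  have s0: "s \<ge> 0"
    unfolding s_def by (intro sum_nonneg) auto
  show ?thesis
  proof (cases "s = 0")
    case True
    then have "f i = 0" if "i < n" for i
      using that unfolding s_def by (subst (asm) sum_nonneg_eq_0_iff) auto
    then show ?thesis
      by (simp add: sesq_form_def)
  next
    case False
    define r where "r = 1 / sqrt s"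
    define g where "g i = (if i < n then of_real r * f i else 0)" for i
    have r2: "r * r * s = 1"
      using False s0 by (simp add: r_def)
    have "(\<Sum>i<n. (cmod (g i))\<^sup>2) = r * r * s"
      unfolding s_def sum_distrib_left
      by (intro sum.cong) (auto simp: g_def norm_mult power_mult_distrib power2_eq_square)
    with r2 have "g \<in> unit_csphere n"
      by (simp add: unit_csphere_def g_def)
    from lb[OF this] have "c \<le> Re (sesq_form n m g g)" .
    also have "sesq_form n m g g = sesq_form n m (\<lambda>i. of_real r * f i) (\<lambda>i. of_real r * f i)"
      unfolding sesq_form_def by (intro sum.cong arg_cong2[where f = "(*)"]) (auto simp: g_def)
    also have "Re \<dots> = r * r * Re (sesq_form n m f f)"
      by (simp add: sesq_form_scale_left sesq_form_scale_right)
    finally have "c * s \<le> r * r * Re (sesq_form n m f f) * s"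
      using s0 by (intro mult_right_mono)
    also have "\<dots> = (r * r * s) * Re (sesq_form n m f f)"
      by (simp add: mult_ac)
    finally show ?thesis
      by (simp add: r2 flip: s_def)
  qed
qed

section \<open>The smallest eigenvalue of a Hermitian matrix\<close>

lemma mat_adjoint_index:
  assumes "M \<in> carrier_mat n n" "i < n" "j < n"
  shows "mat_adjoint M $$ (i, j) = cnj (M $$ (j, i))"
  using assms by (simp add: mat_adjoint_def mat_of_rows_def)

lemma mat_adjoint_carrier: "M \<in> carrier_mat n n \<Longrightarrow> mat_adjoint M \<in> carrier_mat n n"
  by (auto simp: mat_adjoint_def)

lemma hermitian_mat_iff:
  assumes "M \<in> carrier_mat n n"
  shows "hermitian_mat M \<longleftrightarrow> (\<forall>i<n. \<forall>j<n. M $$ (i, j) = cnj (M $$ (j, i)))"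
proof -
  have "mat_adjoint M = M \<longleftrightarrow> (\<forall>i<n. \<forall>j<n. mat_adjoint M $$ (i, j) = M $$ (i, j))"
    using assms mat_adjoint_carrier[OF assms] by (auto intro!: eq_matI)
  also have "\<dots> \<longleftrightarrow> (\<forall>i<n. \<forall>j<n. cnj (M $$ (j, i)) = M $$ (i, j))"
    using mat_adjoint_index[OF assms] by (metis (no_types, lifting))
  finally show ?thesis
    unfolding hermitian_mat_def by (metis (no_types, lifting))
qed

lemma cscalar_prod_mat_vec:
  assumes "M \<in> carrier_mat n n"
  shows "(M *\<^sub>v vec n f) \<bullet>c vec n g = sesq_form n (\<lambda>i j. M $$ (i, j)) f g"
  using assms by (simp add: scalar_prod_def sesq_form_def lessThan_atLeast0)

text \<open>Compactness gives a minimizer \<open>f\<close> of the form on the sphere, with value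
  \<open>c\<close>. The form shifted by \<open>c\<close> is semidefinite and vanishes at
  \<open>f\<close>, so \<open>f\<close> is an eigenvector for \<open>c\<close>. Testing the form on
  an arbitrary eigenvector shows that no eigenvalue has real part below \<open>c\<close>.\<close>

lemma lambda_min_rayleigh:
  assumes M: "M \<in> carrier_mat n n" "hermitian_mat M" and n: "n > 0"
  obtains f where "f \<in> unit_csphere n" "Re (sesq_form n (\<lambda>i j. M $$ (i, j)) f f) = lambda_min M"
    and "\<And>g. lambda_min M * (\<Sum>i<n. (cmod (g i))\<^sup>2) \<le> Re (sesq_form n (\<lambda>i j. M $$ (i, j)) g g)"
proof -
  let ?m = "\<lambda>i j. M $$ (i, j)"
  have herm: "?m i j = cnj (?m j i)" if "i < n" "j < n" for i j
    using M that hermitian_mat_iff by blast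
  have "continuous_on (unit_csphere n) (\<lambda>f. Re (sesq_form n ?m f f))"
    unfolding sesq_form_def
    by (intro continuous_intros continuous_on_subset[OF continuous_on_product_coordinates]) auto
  from continuous_attains_inf[OF compact_unit_csphere unit_csphere_nonempty[OF n] this]
  obtain f where f: "f \<in> unit_csphere n"
    and min: "\<And>g. g \<in> unit_csphere n \<Longrightarrow> Re (sesq_form n ?m f f) \<le> Re (sesq_form n ?m g g)"
    by blast
  define c where "c = Re (sesq_form n ?m f f)"
  have lb: "c * (\<Sum>i<n. (cmod (g i))\<^sup>2) \<le> Re (sesq_form n ?m g g)" for g
    using min by (intro sesq_form_normalize) (simp add: c_def)
  have f1: "(\<Sum>i<n. (cmod (f i))\<^sup>2) = 1"
    using f by (simp add: unit_csphere_def)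
  have ker: "(\<Sum>j<n. (?m i j - (if i = j then of_real c else 0)) * f j) = 0" if "i < n" for i
  proof (rule psd_sesq_form_kernel[OF _ _ _ that])
    show "?m i j - (if i = j then of_real c else 0)
        = cnj (?m j i - (if j = i then of_real c else 0))" if "i < n" "j < n" for i j
      by (subst herm[OF that]) auto
    show "0 \<le> Re (sesq_form n (\<lambda>i j. ?m i j - (if i = j then of_real c else 0)) g g)" for g
      using lb[of g] by (simp add: sesq_form_diff_scalar)
    show "Re (sesq_form n (\<lambda>i j. ?m i j - (if i = j then of_real c else 0)) f f) = 0"
      by (simp add: sesq_form_diff_scalar f1 c_def)
  qed
  have eig: "(\<Sum>j<n. ?m i j * f j) = of_real c * f i" if "i < n" for i
  proof -
    have "(\<Sum>j<n. (if i = j then of_real c else 0) * f j) = (\<Sum>j<n. if j = i then of_real c * f j else 0)"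
      by (intro sum.cong) auto
    also have "\<dots> = of_real c * f i"
      using that by simp
    finally show ?thesis
      using ker[OF that] by (simp add: left_diff_distrib sum_subtractf)
  qed
  have "eigenvector M (vec n f) (of_real c)"
  proof -
    have "vec n f \<noteq> 0\<^sub>v n"
    proof
      assume "vec n f = 0\<^sub>v n"
      then have "f i = 0" if "i < n" for i
        using that by (metis index_vec index_zero_vec(1))
      with f1 show False by simp
    qed
    moreover have "M *\<^sub>v vec n f = of_real c \<cdot>\<^sub>v vec n f"
      using M eig by (intro eq_vecI) (auto simp: scalar_prod_def lessThan_atLeast0)
    ultimately show ?thesis
      using M by (simp add: eigenvector_def)
  qed
  then have mem: "of_real c \<in> spectrum M"
    by (auto simp: spectrum_def eigenvalue_def)
  have le: "c \<le> Re l" if "l \<in> spectrum M" for l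
  proof -
    from that obtain v where v: "v \<in> carrier_vec n" "v \<noteq> 0\<^sub>v n" "M *\<^sub>v v = l \<cdot>\<^sub>v v"
      using M by (auto simp: spectrum_def eigenvalue_def eigenvector_def)
    define g where "g = (\<lambda>i. v $ i)"
    have vg: "v = vec n g"
      using v by (auto simp: g_def)
    define s where "s = (\<Sum>i<n. (cmod (g i))\<^sup>2)"
    have "s \<noteq> 0"
    proof
      assume "s = 0"
      then have "g i = 0" if "i < n" for i
        using that unfolding s_def by (subst (asm) sum_nonneg_eq_0_iff) auto
      with v show False
        by (auto simp: vg)
    qed
    moreover have "s \<ge> 0"
      unfolding s_def by (intro sum_nonneg) auto
    ultimately have s: "s > 0" by simp
    have "sesq_form n ?m g g = (l \<cdot>\<^sub>v v) \<bullet>c v"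
      using cscalar_prod_mat_vec[OF M(1), of g g] v by (simp add: vg)
    also have "\<dots> = l * of_real s"
      using v
      by (simp add: vg scalar_prod_def s_def sum_distrib_left
          lessThan_atLeast0 mult.assoc complex_norm_square del: of_real_power)
    finally have "sesq_form n ?m g g = l * of_real s" .
    with lb[of g] have "c * s \<le> Re l * s"
      by (simp add: s_def)
    with s show ?thesis by simp
  qed
  have "lambda_min M = c"
    unfolding lambda_min_def
  proof (rule Min_eqI)
    show "finite (Re ` spectrum M)"
      using card_finite_spectrum[OF M(1)] by simp
    show "c \<in> Re ` spectrum M"
      using mem by force
  qed (use le in auto)
  with that[OF f] lb show ?thesis
    by (simp add: c_def)
qed

text \<open>The diagonal entries are the values of the form at the standard basis vectors
  \<open>e k\<close>, so the Rayleigh bound can be summed over \<open>k\<close>.\<close>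

lemma lambda_min_trace:
  assumes M: "M \<in> carrier_mat n n" "hermitian_mat M" and n: "n > 0"
  shows "lambda_min M * n \<le> Re (mat_trace M)"
    and "lambda_min M * n = Re (mat_trace M) \<Longrightarrow> M = of_real (lambda_min M) \<cdot>\<^sub>m 1\<^sub>m n"
proof -
  define c where "c = lambda_min M"
  let ?m = "\<lambda>i j. M $$ (i, j)"
  define e :: "nat \<Rightarrow> nat \<Rightarrow> complex" where "e k i = (if i = k then 1 else 0)" for k i
  have herm: "?m i j = cnj (?m j i)" if "i < n" "j < n" for i j
    using M that hermitian_mat_iff by blast
  have ray: "c * (\<Sum>i<n. (cmod (g i))\<^sup>2) \<le> Re (sesq_form n ?m g g)" for g
    using lambda_min_rayleigh[OF M n] unfolding c_def by metis
  have col: "(\<Sum>j<n. m i j * e k j) = m i k" if "k < n" for m :: "nat \<Rightarrow> nat \<Rightarrow> complex" and i k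
  proof -
    have "(\<Sum>j<n. m i j * e k j) = (\<Sum>j<n. if j = k then m i k else 0)"
      by (intro sum.cong) (auto simp: e_def)
    with that show ?thesis by simp
  qed
  have form: "sesq_form n m (e k) (e k) = m k k" if "k < n" for m k
  proof -
    have "sesq_form n m (e k) (e k) = (\<Sum>i<n. if i = k then m k k else 0)"
      unfolding sesq_form_def col[OF that] by (intro sum.cong) (auto simp: e_def)
    with that show ?thesis by simp
  qed
  have norm: "(\<Sum>i<n. (cmod (e k i))\<^sup>2) = 1" if "k < n" for k
  proof -
    have "(\<Sum>i<n. (cmod (e k i))\<^sup>2) = (\<Sum>i<n. if i = k then 1 else 0 :: real)"
      by (intro sum.cong) (auto simp: e_def)
    with that show ?thesis by simp
  qed
  have diag: "c \<le> Re (?m k k)" if "k < n" for k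
    using ray[of "e k"] that by (simp add: form norm)
  have tr: "Re (mat_trace M) = (\<Sum>k<n. Re (?m k k))"
    using M by (simp add: mat_trace_def)
  have "lambda_min M * n = (\<Sum>k<n. c)"
    by (simp add: c_def)
  also have "\<dots> \<le> Re (mat_trace M)"
    unfolding tr by (intro sum_mono) (simp add: diag)
  finally show "lambda_min M * n \<le> Re (mat_trace M)" .
  show "M = of_real (lambda_min M) \<cdot>\<^sub>m 1\<^sub>m n" if eq: "lambda_min M * n = Re (mat_trace M)"
  proof -
    \<comment> \<open>The terms are nonnegative by \<open>diag\<close>, so equality in the trace
      bound forces equality in each diagonal entry.\<close>
    have "(\<Sum>k<n. Re (?m k k) - c) = 0"
      using eq by (simp add: tr sum_subtractf c_def mult.commute)
    then have dk: "Re (?m k k) = c" if "k < n" for k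
      using diag that by (subst (asm) sum_nonneg_eq_0_iff) auto
    \<comment> \<open>Each basis vector is a zero of the shifted semidefinite form, so every column
      of the shifted matrix vanishes.\<close>
    have "(\<Sum>j<n. (?m i j - (if i = j then of_real c else 0)) * e k j) = 0"
      if "i < n" "k < n" for i k
    proof (rule psd_sesq_form_kernel[OF _ _ _ \<open>i < n\<close>])
      show "?m i j - (if i = j then of_real c else 0)
          = cnj (?m j i - (if j = i then of_real c else 0))" if "i < n" "j < n" for i j
        by (subst herm[OF that]) auto
      show "0 \<le> Re (sesq_form n (\<lambda>i j. ?m i j - (if i = j then of_real c else 0)) g g)" for g
        using ray[of g] by (simp add: sesq_form_diff_scalar)
      show "Re (sesq_form n (\<lambda>i j. ?m i j - (if i = j then of_real c else 0)) (e k) (e k)) = 0"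
        using that by (simp add: form dk)
    qed
    then have "?m i k - (if i = k then of_real c else 0) = 0" if "i < n" "k < n" for i k
      using that by (metis (lifting) col[of k "\<lambda>i j. ?m i j - (if i = j then of_real c else 0)" i])
    then have "?m i k = (if i = k then of_real c else 0)" if "i < n" "k < n" for i k
      using that by (metis eq_iff_diff_eq_0)
    then show ?thesis
      using M by (intro eq_matI) (auto simp: c_def)
  qed
qed

lemma sesq_form_one: "sesq_form n (\<lambda>i j. if i = j then c else 0) f f = c * of_real (\<Sum>i<n. (cmod (f i))\<^sup>2)"
  using sesq_form_diff_scalar[of n "\<lambda>_ _. 0" "- c" f] by (simp add: sesq_form_def if_distrib cong: if_cong)

text \<open>The form of a scalar matrix is constant on the sphere, so its minimum is that
  constant.\<close>

lemma lambda_min_scalar: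
  assumes "n > 0"
  shows "lambda_min (of_real c \<cdot>\<^sub>m 1\<^sub>m n) = c"
proof -
  let ?M = "of_real c \<cdot>\<^sub>m 1\<^sub>m n :: complex mat"
  have M: "?M \<in> carrier_mat n n"
    by simp
  moreover have "hermitian_mat ?M"
    unfolding hermitian_mat_iff[OF M] by auto
  ultimately obtain f where f: "f \<in> unit_csphere n"
    and eq: "Re (sesq_form n (\<lambda>i j. ?M $$ (i, j)) f f) = lambda_min ?M"
    using lambda_min_rayleigh[OF _ _ assms] by metis
  have "sesq_form n (\<lambda>i j. ?M $$ (i, j)) f f = sesq_form n (\<lambda>i j. if i = j then of_real c else 0) f f"
    unfolding sesq_form_def by (intro sum.cong arg_cong2[where f = "(*)"]) auto
  with eq f show ?thesis
    by (simp add: sesq_form_one unit_csphere_def)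
qed

section \<open>Diagonal flows and their Gramians\<close>

lemma mat_diag_smult: "c \<cdot>\<^sub>m mat_diag n f = mat_diag n (\<lambda>j. c * f j :: complex)"
  by (auto simp: mat_diag_def)

lemma mat_adjoint_diag: "mat_adjoint (mat_diag n f) = mat_diag n (\<lambda>j. cnj (f j))"
proof (rule eq_matI)
  fix i j
  assume "i < dim_row (mat_diag n (\<lambda>j. cnj (f j)))" "j < dim_col (mat_diag n (\<lambda>j. cnj (f j)))"
  then have "i < n" "j < n"
    by (auto simp: mat_diag_def)
  then show "mat_adjoint (mat_diag n f) $$ (i, j) = mat_diag n (\<lambda>j. cnj (f j)) $$ (i, j)"
    by (subst mat_adjoint_index[OF mat_diag_dim]) (auto simp: mat_diag_def)
qed (auto simp: mat_diag_def mat_adjoint_def)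

lemma mat_diag_power: "mat_diag n f ^\<^sub>m k = mat_diag n (\<lambda>j. f j ^ k :: complex)"
proof (induction k)
  case 0
  then show ?case
    by (simp add: mat_diag_def[of n f])
next
  case (Suc k)
  then show ?case
    by (simp add: mult.commute)
qed

text \<open>Powers of a diagonal matrix act on each diagonal entry separately, so the diagonal
  carries scalar exponential series and every off-diagonal term is zero.\<close>

lemma mat_exp_diag: "mat_exp (mat_diag n f) = mat_diag n (\<lambda>j. exp (f j))"
proof (rule eq_matI)
  fix i j
  assume "i < dim_row (mat_diag n (\<lambda>j. exp (f j)))" "j < dim_col (mat_diag n (\<lambda>j. exp (f j)))"
  then have ij: "i < n" "j < n"
    by (auto simp: mat_diag_def)
  have "(\<Sum>k. f j ^ k / fact k) = exp (f j)"
    by (simp add: exp_def scaleR_conv_of_real field_simps)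
  with ij show "mat_exp (mat_diag n f) $$ (i, j) = mat_diag n (\<lambda>j. exp (f j)) $$ (i, j)"
    by (simp add: mat_exp_def mat_diag_power) (simp add: mat_diag_def)
qed (auto simp: mat_diag_def mat_exp_def)

text \<open>Closed form of the integral of \<open>exp (- \<i> * d * t)\<close> over
  \<open>{0..T}\<close>; a zero frequency gap gives no oscillation and needs its own value.\<close>

definition phase_integral :: "real \<Rightarrow> real \<Rightarrow> complex" where
  "phase_integral T d = (if d = 0 then of_real T else (1 - exp (- \<i> * of_real (d * T))) / (\<i> * of_real d))"

lemma integral_exp_phase_integral:
  assumes "T \<ge> 0"
  shows "integral {0..T} (\<lambda>t. exp (- \<i> * of_real (d * t))) = phase_integral T d"
proof (cases "d = 0")
  case True
  with assms show ?thesis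
    by (simp add: phase_integral_def scaleR_conv_of_real)
next
  case False
  let ?F = "\<lambda>t :: real. - exp (- \<i> * of_real (d * t)) / (\<i> * of_real d)"
  have "(?F has_vector_derivative exp (- \<i> * of_real (d * t))) (at t within {0..T})" for t
  proof -
    \<comment> \<open>The antiderivative is differentiated in a complex variable, where the field
      rules apply, and then restricted to real \<open>t\<close>.\<close>
    have "((\<lambda>z. - exp (- \<i> * (of_real d * z)) / (\<i> * of_real d)) has_field_derivative
        exp (- \<i> * of_real (d * t))) (at (of_real t))"
      using False by (auto intro!: derivative_eq_intros simp: field_simps)
    from has_vector_derivative_real_field[OF this] show ?thesis
      by simp
  qed
  then have "((\<lambda>t. exp (- \<i> * of_real (d * t))) has_integral (?F T - ?F 0)) {0..T}"
    using assms by (intro fundamental_theorem_of_calculus)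
  then have "integral {0..T} (\<lambda>t. exp (- \<i> * of_real (d * t))) = ?F T - ?F 0"
    by (rule integral_unique)
  with False show ?thesis
    by (simp add: phase_integral_def diff_divide_distrib)
qed

text \<open>This conjugate symmetry makes the Gramian of a Hermitian matrix Hermitian.\<close>

lemma phase_integral_minus: "phase_integral T (- d) = cnj (phase_integral T d)"
  by (simp add: phase_integral_def exp_cnj divide_simps)

lemma phase_integral_eq_0_iff: "d \<noteq> 0 \<Longrightarrow> phase_integral T d = 0 \<longleftrightarrow> exp (- \<i> * of_real (d * T)) = 1"
  by (auto simp: phase_integral_def)

text \<open>At time \<open>t\<close> the flow multiplies the entry \<open>(i, j)\<close> of
  \<open>X\<close> by a phase that depends only on the gap \<open>w i - w j\<close>. The Gramian is
  thus the entrywise product of \<open>X\<close> with a fixed matrix of phase integrals.\<close>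

lemma gramian_op_diag:
  assumes X: "X \<in> carrier_mat n n" and T: "T \<ge> 0"
  shows "gramian_op (mat_diag n (\<lambda>j. - \<i> * of_real (w j))) T X
    = mat n n (\<lambda>(i, j). X $$ (i, j) * phase_integral T (w i - w j))"
proof -
  let ?A = "mat_diag n (\<lambda>j. - \<i> * of_real (w j))"
  have "integral {0..T} (\<lambda>t. (mat_exp (complex_of_real t \<cdot>\<^sub>m ?A) * X
           * mat_exp (complex_of_real t \<cdot>\<^sub>m mat_adjoint ?A)) $$ (i, j))
      = X $$ (i, j) * phase_integral T (w i - w j)" if ij: "i < n" "j < n" for i j
  proof -
    have "(mat_exp (complex_of_real t \<cdot>\<^sub>m ?A) * X
           * mat_exp (complex_of_real t \<cdot>\<^sub>m mat_adjoint ?A)) $$ (i, j)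
       = X $$ (i, j) * exp (- \<i> * of_real ((w i - w j) * t))" for t
    proof -
      have "(mat_exp (complex_of_real t \<cdot>\<^sub>m ?A) * X
           * mat_exp (complex_of_real t \<cdot>\<^sub>m mat_adjoint ?A)) $$ (i, j)
        = X $$ (i, j) * (exp (t * (- \<i> * of_real (w i))) * exp (t * (\<i> * of_real (w j))))"
        using ij X
        by (simp add: mat_adjoint_diag mat_diag_smult mat_exp_diag mat_diag_mult_left
            mat_diag_mult_right[where nr = n])
      also have "exp (t * (- \<i> * of_real (w i))) * exp (t * (\<i> * of_real (w j)))
        = exp (- \<i> * of_real ((w i - w j) * t))"
        by (simp add: algebra_simps flip: exp_add)
      finally show ?thesis .
    qed
    then show ?thesis
      by (simp only: integral_mult_right integral_exp_phase_integral[OF T])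
  qed
  then show ?thesis
    unfolding gramian_op_def by (intro eq_matI) (auto simp: mat_diag_def)
qed

section \<open>Rank-one profiles and maximization over the sphere\<close>

lemma rank_one_index:
  assumes "i < n" "j < n"
  shows "rank_one (vec n f) $$ (i, j) = f i * cnj (f j)"
  using assms
  by (simp add: rank_one_def Let_def mat_adjoint_def scalar_prod_def mat_of_cols_def mat_of_rows_def)

lemma rank_one_carrier: "rank_one (vec n f) \<in> carrier_mat n n"
  by (auto simp: rank_one_def Let_def mat_adjoint_def)

lemma cvec_norm_vec: "cvec_norm (vec n f) = sqrt (\<Sum>i<n. (cmod (f i))\<^sup>2)"
proof -
  have "vec n f \<bullet>c vec n f = of_real (\<Sum>i<n. (cmod (f i))\<^sup>2)"
    by (simp add: scalar_prod_def lessThan_atLeast0 complex_norm_square del: of_real_power)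
  then show ?thesis
    by (simp add: cvec_norm_def)
qed

text \<open>Transfers the optimization over unit profiles to a compact topological space.\<close>

lemma unit_profiles_eq: "unit_profiles n = vec n ` unit_csphere n"
proof (intro equalityI subsetI)
  fix b assume "b \<in> unit_profiles n"
  then have b: "b \<in> carrier_vec n" "cvec_norm b = 1"
    by (auto simp: unit_profiles_def)
  define f where "f = (\<lambda>i. if i < n then vec_index b i else 0)"
  have bf: "b = vec n f"
    using b by (auto simp: f_def)
  moreover have "f \<in> unit_csphere n"
    using b(2) unfolding bf cvec_norm_vec by (simp add: unit_csphere_def f_def)
  ultimately show "b \<in> vec n ` unit_csphere n" by blast
qed (auto simp: unit_profiles_def unit_csphere_def cvec_norm_vec)

text \<open>\<open>m\<close> is an infimum of functions continuous in \<open>b\<close>, hence upper semicontinuous.\<close>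

lemma compact_max_of_min:
  fixes F :: "'a::topological_space \<Rightarrow> 'b \<Rightarrow> real"
  assumes S: "compact S" "S \<noteq> {}"
    and cont: "\<And>v. v \<in> V \<Longrightarrow> continuous_on UNIV (\<lambda>b. F b v)"
    and le: "\<And>b v. b \<in> S \<Longrightarrow> v \<in> V \<Longrightarrow> m b \<le> F b v"
    and attained: "\<And>b. b \<in> S \<Longrightarrow> \<exists>v\<in>V. m b = F b v"
  shows "\<exists>b\<in>S. \<forall>c\<in>S. m c \<le> m b"
proof (rule ccontr)
  assume "\<not> ?thesis"
  then have nomax: "\<And>b. b \<in> S \<Longrightarrow> \<exists>c\<in>S. m b < m c"
    by (meson not_le)
  \<comment> \<open>If no point maximizes \<open>m\<close>, each \<open>b\<close> has a test
    \<open>v\<close> realizing \<open>m b\<close> and a strictly better competitor \<open>c\<close>,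
    so the open sets \<open>U (v, c)\<close> cover \<open>S\<close>.\<close>
  define U where "U = (\<lambda>(v, c). {b. F b v < m c})"
  have "open (U p)" if "p \<in> V \<times> S" for p
    using that by (auto simp: U_def intro!: open_Collect_less cont)
  moreover have "S \<subseteq> (\<Union>p\<in>V \<times> S. U p)"
  proof
    fix b assume "b \<in> S"
    then obtain v c where "v \<in> V" "m b = F b v" "c \<in> S" "m b < m c"
      using attained nomax by meson
    then show "b \<in> (\<Union>p\<in>V \<times> S. U p)"
      by (auto simp: U_def)
  qed
  ultimately obtain C where C: "C \<subseteq> V \<times> S" "finite C" "S \<subseteq> (\<Union>p\<in>C. U p)"
    using compactE_image[OF S(1)] by metis
  have "C \<noteq> {}"
    using C S by auto
  \<comment> \<open>The best of the finitely many competitors lies in some set of the subcover,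
    whose own competitor is strictly better: a contradiction.\<close>
  define M where "M = Max ((\<lambda>p. m (snd p)) ` C)"
  have "M \<in> (\<lambda>p. m (snd p)) ` C"
    unfolding M_def using C \<open>C \<noteq> {}\<close> by (intro Max_in) auto
  then obtain p where p: "p \<in> C" "M = m (snd p)"
    by auto
  then have "snd p \<in> S"
    using C by auto
  with C obtain q where q: "q \<in> C" "snd p \<in> U q"
    by auto
  then have "m (snd p) \<le> F (snd p) (fst q)"
    using C \<open>snd p \<in> S\<close> by (intro le) auto
  also have "\<dots> < m (snd q)"
    using q by (auto simp: U_def split: prod.splits)
  also have "\<dots> \<le> M"
    unfolding M_def using C q by (intro Max_ge) auto
  finally show False
    using p by simp
qed

section \<open>Scalar and relaxed values for arbitrary real frequencies\<close>

definition diag_generator :: "nat \<Rightarrow> (nat \<Rightarrow> real) \<Rightarrow> complex mat" where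
  "diag_generator n w = mat_diag n (\<lambda>j. - \<i> * of_real (w j))"

lemma dim_diag_generator [simp]: "dim_row (diag_generator n w) = n"
  by (simp add: diag_generator_def mat_diag_def)

lemma gramian_op_carrier: "gramian_op (diag_generator n w) T X \<in> carrier_mat n n"
  by (simp add: gramian_op_def)

lemma gramian_op_index:
  assumes "X \<in> carrier_mat n n" "T \<ge> 0" "i < n" "j < n"
  shows "gramian_op (diag_generator n w) T X $$ (i, j) = X $$ (i, j) * phase_integral T (w i - w j)"
  unfolding diag_generator_def gramian_op_diag[OF assms(1,2)] using assms by simp

lemma hermitian_gramian_op:
  assumes X: "X \<in> carrier_mat n n" "hermitian_mat X" and T: "T \<ge> 0"
  shows "hermitian_mat (gramian_op (diag_generator n w) T X)"
  unfolding hermitian_mat_iff[OF gramian_op_carrier]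
proof (intro allI impI)
  fix i j assume ij: "i < n" "j < n"
  then have "X $$ (i, j) = cnj (X $$ (j, i))"
    using X hermitian_mat_iff by blast
  moreover have "phase_integral T (w i - w j) = cnj (phase_integral T (w j - w i))"
    using phase_integral_minus[of T "w j - w i"] by simp
  ultimately show "gramian_op (diag_generator n w) T X $$ (i, j)
      = cnj (gramian_op (diag_generator n w) T X $$ (j, i))"
    using ij X(1) T by (simp only: gramian_op_index complex_cnj_mult)
qed

text \<open>Frequency gaps on the diagonal are zero, so each phase integral there is
  \<open>T\<close>.\<close>

lemma trace_gramian_op:
  assumes "X \<in> carrier_mat n n" "T \<ge> 0"
  shows "mat_trace (gramian_op (diag_generator n w) T X) = of_real T * mat_trace X"
  using assms gramian_op_carrier[of n w T X]
  by (simp add: mat_trace_def gramian_op_index phase_integral_def sum_distrib_left mult.commute)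

text \<open>The Gramian has trace \<open>T\<close>, so the trace bound gives \<open>T / n\<close>,
  and its equality case forces a scalar matrix.\<close>

lemma lambda_min_gramian_op:
  assumes X: "X \<in> carrier_mat n n" "hermitian_mat X" "mat_trace X = 1"
    and T: "T \<ge> 0" and n: "n > 0"
  shows "lambda_min (gramian_op (diag_generator n w) T X) \<le> T / n"
    and "lambda_min (gramian_op (diag_generator n w) T X) = T / n \<longleftrightarrow>
      gramian_op (diag_generator n w) T X = of_real (T / n) \<cdot>\<^sub>m 1\<^sub>m n"
proof -
  let ?G = "gramian_op (diag_generator n w) T X"
  have tr: "Re (mat_trace ?G) = T"
    by (simp add: trace_gramian_op X T)
  note G = gramian_op_carrier hermitian_gramian_op[OF X(1,2) T, of w]
  show "lambda_min ?G \<le> T / n"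
    using lambda_min_trace(1)[OF G n] n by (simp add: tr field_simps)
  show "lambda_min ?G = T / n \<longleftrightarrow> ?G = of_real (T / n) \<cdot>\<^sub>m 1\<^sub>m n"
  proof
    assume eq: "lambda_min ?G = T / n"
    then have "lambda_min ?G * n = Re (mat_trace ?G)"
      using n by (simp add: tr)
    from lambda_min_trace(2)[OF G n this] show "?G = of_real (T / n) \<cdot>\<^sub>m 1\<^sub>m n"
      by (simp add: eq)
  next
    assume "?G = of_real (T / n) \<cdot>\<^sub>m 1\<^sub>m n"
    then show "lambda_min ?G = T / n"
      by (simp only: lambda_min_scalar[OF n])
  qed
qed

text \<open>The bound is attained at the identity divided by \<open>n\<close>: off the diagonal this
  profile vanishes, and on it every phase integral is \<open>T\<close>.\<close>

lemma relaxed_values_greatest: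
  assumes T: "T \<ge> 0" and n: "n > 0"
  shows "T / n \<in> relaxed_values (diag_generator n w) T"
    and "v \<in> relaxed_values (diag_generator n w) T \<Longrightarrow> v \<le> T / n"
proof -
  define X :: "complex mat" where "X = of_real (1 / n) \<cdot>\<^sub>m 1\<^sub>m n"
  have X: "X \<in> carrier_mat n n"
    by (simp add: X_def)
  have herm: "hermitian_mat X"
    unfolding hermitian_mat_iff[OF X] by (auto simp: X_def)
  have tr: "mat_trace X = 1"
    using n by (simp add: mat_trace_def X_def)
  have psd: "psd_mat X"
    unfolding psd_mat_def
  proof
    fix v :: "complex Matrix.vec" assume "v \<in> carrier_vec (dim_row X)"
    then have v: "v \<in> carrier_vec n"
      using X by simp
    define f where "f = (\<lambda>i. vec_index v i)"
    have vf: "v = vec n f"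
      using v by (auto simp: f_def)
    have "sesq_form n (\<lambda>i j. X $$ (i, j)) f f = sesq_form n (\<lambda>i j. if i = j then of_real (1 / n) else 0) f f"
      unfolding sesq_form_def by (intro sum.cong arg_cong2[where f = "(*)"]) (auto simp: X_def)
    then have "(X *\<^sub>v v) \<bullet>c v = of_real (1 / n) * of_real (\<Sum>i<n. (cmod (f i))\<^sup>2)"
      unfolding vf cscalar_prod_mat_vec[OF X] sesq_form_one .
    then show "0 \<le> Re ((X *\<^sub>v v) \<bullet>c v)"
      by (simp add: sum_nonneg)
  qed
  have "gramian_op (diag_generator n w) T X = of_real (T / n) \<cdot>\<^sub>m 1\<^sub>m n"
    using T gramian_op_carrier[of n w T X] X
    by (intro eq_matI) (auto simp: gramian_op_index phase_integral_def X_def)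
  then have "lambda_min (gramian_op (diag_generator n w) T X) = T / n"
    by (simp only: lambda_min_scalar[OF n])
  then show "T / n \<in> relaxed_values (diag_generator n w) T"
    unfolding relaxed_values_def dim_diag_generator relaxed_profiles_def using X herm psd tr
    by (metis (mono_tags, lifting) image_eqI mem_Collect_eq)
  show "v \<le> T / n" if "v \<in> relaxed_values (diag_generator n w) T"
    using that lambda_min_gramian_op(1)[OF _ _ _ T n]
    by (auto simp: relaxed_values_def relaxed_profiles_def)
qed

lemma has_max_relaxed_values:
  "T \<ge> 0 \<Longrightarrow> n > 0 \<Longrightarrow> has_max (relaxed_values (diag_generator n w) T)"
  unfolding has_max_def using relaxed_values_greatest by blast

lemma relaxed_value_eq: "T \<ge> 0 \<Longrightarrow> n > 0 \<Longrightarrow> relaxed_value (diag_generator n w) T = T / n"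
  unfolding relaxed_value_def using relaxed_values_greatest by (intro Greatest_equality) auto

lemma rank_one_profile:
  assumes "f \<in> unit_csphere n"
  shows "hermitian_mat (rank_one (vec n f))" "mat_trace (rank_one (vec n f)) = 1"
proof -
  show "hermitian_mat (rank_one (vec n f))"
    unfolding hermitian_mat_iff[OF rank_one_carrier] by (auto simp: rank_one_index)
  have "mat_trace (rank_one (vec n f)) = of_real (\<Sum>i<n. (cmod (f i))\<^sup>2)"
    using rank_one_carrier[of n f]
    by (simp add: mat_trace_def rank_one_index complex_norm_square del: of_real_power)
  with assms show "mat_trace (rank_one (vec n f)) = 1"
    by (simp add: unit_csphere_def)
qed

text \<open>Membership in \<open>unit_csphere n\<close> becomes a premise twice, once for Hermitian
  symmetry and once for the trace; later uses therefore discharge it twice.\<close>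

lemmas lambda_min_gramian =
  lambda_min_gramian_op[OF rank_one_carrier rank_one_profile, folded gramian_def]

text \<open>\<open>F f g\<close> is the form of the Gramian of \<open>f\<close> at \<open>g\<close>.
  It is continuous in \<open>f\<close> for fixed \<open>g\<close>, and its minimum over
  \<open>g\<close> is the smallest eigenvalue, so \<open>compact_max_of_min\<close> applies with the
  sphere as both \<open>S\<close> and \<open>V\<close>.\<close>

lemma has_max_scalar_values:
  assumes T: "T \<ge> 0" and n: "n > 0"
  shows "has_max (scalar_values (diag_generator n w) T)"
proof -
  define F where "F f g = Re (sesq_form n (\<lambda>i j. f i * cnj (f j) * phase_integral T (w i - w j)) g g)" for f g
  define m where "m f = lambda_min (gramian (diag_generator n w) T (vec n f))" for f
  have form: "sesq_form n (\<lambda>i j. gramian (diag_generator n w) T (vec n f) $$ (i, j)) g g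
      = sesq_form n (\<lambda>i j. f i * cnj (f j) * phase_integral T (w i - w j)) g g" for f g
    unfolding sesq_form_def gramian_def
    by (intro sum.cong arg_cong2[where f = "(*)"] refl)
       (simp add: gramian_op_index[OF rank_one_carrier T] rank_one_index)
  have "\<exists>f\<in>unit_csphere n. \<forall>g\<in>unit_csphere n. m g \<le> m f"
  proof (rule compact_max_of_min)
    show "compact (unit_csphere n)" "unit_csphere n \<noteq> {}"
      using compact_unit_csphere unit_csphere_nonempty n by auto
    show "continuous_on UNIV (\<lambda>f. F f g)" if "g \<in> unit_csphere n" for g
      unfolding F_def sesq_form_def
      by (intro continuous_intros continuous_on_product_coordinates)
    fix f assume f: "f \<in> unit_csphere n"
    have G: "gramian (diag_generator n w) T (vec n f) \<in> carrier_mat n n"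
      "hermitian_mat (gramian (diag_generator n w) T (vec n f))"
      unfolding gramian_def
      using gramian_op_carrier hermitian_gramian_op[OF rank_one_carrier rank_one_profile(1)[OF f] T]
      by auto
    obtain h where h: "h \<in> unit_csphere n"
      and eq: "Re (sesq_form n (\<lambda>i j. gramian (diag_generator n w) T (vec n f) $$ (i, j)) h h) = m f"
      and lb: "\<And>g. m f * (\<Sum>i<n. (cmod (g i))\<^sup>2)
        \<le> Re (sesq_form n (\<lambda>i j. gramian (diag_generator n w) T (vec n f) $$ (i, j)) g g)"
      unfolding m_def by (rule lambda_min_rayleigh[OF G n]) blast
    show "m f \<le> F f g" if "g \<in> unit_csphere n" for g
      using lb[of g] that by (simp add: unit_csphere_def form F_def)
    show "\<exists>g\<in>unit_csphere n. m f = F f g"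
      using h eq by (intro bexI[of _ h]) (simp_all add: form F_def)
  qed
  then show ?thesis
    unfolding has_max_def scalar_values_def dim_diag_generator unit_profiles_eq image_image m_def
    by blast
qed

lemma scalar_value_greatest:
  assumes "T \<ge> 0" "n > 0"
  shows "scalar_value (diag_generator n w) T \<in> scalar_values (diag_generator n w) T"
    and "v \<in> scalar_values (diag_generator n w) T \<Longrightarrow> v \<le> scalar_value (diag_generator n w) T"
proof -
  obtain m where m: "m \<in> scalar_values (diag_generator n w) T"
    and max: "\<And>v. v \<in> scalar_values (diag_generator n w) T \<Longrightarrow> v \<le> m"
    using has_max_scalar_values[OF assms] unfolding has_max_def by blast
  then have "scalar_value (diag_generator n w) T = m"
    unfolding scalar_value_def by (intro Greatest_equality) auto
  with m max show "scalar_value (diag_generator n w) T \<in> scalar_values (diag_generator n w) T"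
    and "v \<in> scalar_values (diag_generator n w) T \<Longrightarrow> v \<le> scalar_value (diag_generator n w) T"
    by auto
qed

section \<open>Exact recovery and the maximizing profiles\<close>

lemma gramian_eq_scalar_iff:
  assumes T: "T > 0" and n: "n > 0" and w: "inj_on w {..<n}"
  shows "gramian (diag_generator n w) T (vec n f) = of_real (T / n) \<cdot>\<^sub>m 1\<^sub>m n \<longleftrightarrow>
    (\<forall>i<n. (cmod (f i))\<^sup>2 = 1 / n)
      \<and> (\<forall>i<n. \<forall>j<n. exp (- \<i> * of_real (w i * T)) = exp (- \<i> * of_real (w j * T)))"
    (is "?G = ?D \<longleftrightarrow> ?mod \<and> ?exp")
proof -
  have G: "?G \<in> carrier_mat n n"
    unfolding gramian_def by (rule gramian_op_carrier)
  have entry: "?G $$ (i, j) = f i * cnj (f j) * phase_integral T (w i - w j)" if "i < n" "j < n" for i j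
    using that T by (simp add: gramian_def gramian_op_index[OF rank_one_carrier] rank_one_index)
  have "?G = ?D \<longleftrightarrow> (\<forall>i<n. \<forall>j<n. ?G $$ (i, j) = ?D $$ (i, j))"
    using G by (auto intro!: eq_matI)
  also have "\<dots> \<longleftrightarrow> (\<forall>i<n. \<forall>j<n. f i * cnj (f j) * phase_integral T (w i - w j)
      = (if i = j then of_real (T / n) else 0))"
    by (simp add: entry)
  \<comment> \<open>The equations split into the diagonal ones, which fix the moduli, and the
    off-diagonal ones, which involve oscillatory integrals.\<close>
  also have "\<dots> \<longleftrightarrow> (\<forall>i<n. f i * cnj (f i) * of_real T = of_real (T / n))
      \<and> (\<forall>i<n. \<forall>j<n. i \<noteq> j \<longrightarrow> f i * cnj (f j) * phase_integral T (w i - w j) = 0)"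
    by (auto simp: phase_integral_def)
  also have "(\<forall>i<n. f i * cnj (f i) * of_real T = of_real (T / n)) \<longleftrightarrow> ?mod"
  proof -
    have "f i * cnj (f i) * of_real T = of_real (T / n) \<longleftrightarrow> (cmod (f i))\<^sup>2 = 1 / n" for i
    proof -
      have "f i * cnj (f i) * of_real T = of_real ((cmod (f i))\<^sup>2 * T)"
        by (simp only: of_real_mult complex_norm_square)
      then have "f i * cnj (f i) * of_real T = of_real (T / n) \<longleftrightarrow> (cmod (f i))\<^sup>2 * T = T / n"
        by (simp only: of_real_eq_iff)
      also have "\<dots> \<longleftrightarrow> (cmod (f i))\<^sup>2 = 1 / n"
        using T n by (auto simp: field_simps)
      finally show ?thesis .
    qed
    then show ?thesis by simp
  qed
  also have "?mod \<and> (\<forall>i<n. \<forall>j<n. i \<noteq> j \<longrightarrow> f i * cnj (f j) * phase_integral T (w i - w j) = 0)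
      \<longleftrightarrow> ?mod \<and> ?exp"
  \<comment> \<open>Given the moduli, no entry of \<open>f\<close> vanishes, so the off-diagonal
    equations constrain only the phase integrals. Injectivity of \<open>w\<close> makes the gaps
    there nonzero.\<close>
  proof (rule conj_cong[OF refl])
    assume mod: ?mod
    have nz: "f i \<noteq> 0" if "i < n" for i
    proof
      assume "f i = 0"
      with mod that have "1 / real n = 0"
        by (metis norm_zero zero_power2)
      with n show False by simp
    qed
    have "f i * cnj (f j) * phase_integral T (w i - w j) = 0 \<longleftrightarrow>
        exp (- \<i> * of_real (w i * T)) = exp (- \<i> * of_real (w j * T))"
      if "i < n" "j < n" "i \<noteq> j" for i j
    proof -
      have "w i - w j \<noteq> 0"
        using w that by (auto dest: inj_onD)
      then have "f i * cnj (f j) * phase_integral T (w i - w j) = 0 \<longleftrightarrow>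
          exp (- \<i> * of_real ((w i - w j) * T)) = 1"
        using nz that by (simp add: phase_integral_eq_0_iff)
      also have "- \<i> * of_real ((w i - w j) * T)
          = - \<i> * of_real (w i * T) - (- \<i> * of_real (w j * T))"
        by (simp add: algebra_simps)
      also have "exp \<dots> = 1 \<longleftrightarrow> exp (- \<i> * of_real (w i * T)) = exp (- \<i> * of_real (w j * T))"
        by (subst exp_diff) (simp add: divide_eq_1_iff)
      finally show ?thesis .
    qed
    then show "(\<forall>i<n. \<forall>j<n. i \<noteq> j \<longrightarrow> f i * cnj (f j) * phase_integral T (w i - w j) = 0) \<longleftrightarrow> ?exp"
      by (metis (no_types, lifting))
  qed
  finally show ?thesis .
qed

text \<open>Since the scalar maximum is attained, exactness means that some unit profile has Gramian
  \<open>T / n\<close> times the identity.\<close>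

lemma scalar_recovery_iff:
  assumes T: "T > 0" and n: "n > 0" and w: "inj_on w {..<n}"
  shows "scalar_recovery_exact (diag_generator n w) T \<longleftrightarrow>
    (\<forall>i<n. \<forall>j<n. exp (- \<i> * of_real (w i * T)) = exp (- \<i> * of_real (w j * T)))"
proof
  assume "scalar_recovery_exact (diag_generator n w) T"
  then have "scalar_value (diag_generator n w) T = T / n"
    using T n by (simp add: scalar_recovery_exact_def relaxed_value_eq)
  then obtain f where f: "f \<in> unit_csphere n" "lambda_min (gramian (diag_generator n w) T (vec n f)) = T / n"
    using scalar_value_greatest(1)[of T n w] T n
    by (auto simp: scalar_values_def unit_profiles_eq)
  then have "gramian (diag_generator n w) T (vec n f) = of_real (T / n) \<cdot>\<^sub>m 1\<^sub>m n"
    using lambda_min_gramian(2)[OF f(1) f(1) less_imp_le[OF T] n] by blast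
  then show "\<forall>i<n. \<forall>j<n. exp (- \<i> * of_real (w i * T)) = exp (- \<i> * of_real (w j * T))"
    unfolding gramian_eq_scalar_iff[OF assms] by blast
next
  assume ex: "\<forall>i<n. \<forall>j<n. exp (- \<i> * of_real (w i * T)) = exp (- \<i> * of_real (w j * T))"
  \<comment> \<open>The constant profile has the required moduli; it is extended by zero to lie in
    \<open>unit_csphere n\<close>.\<close>
  define f where "f i = (if i < n then of_real (1 / sqrt n) else 0 :: complex)" for i
  have mod: "(cmod (f i))\<^sup>2 = 1 / n" if "i < n" for i
    using that by (simp add: f_def norm_divide power_divide)
  then have f: "f \<in> unit_csphere n"
    using n by (simp add: unit_csphere_def f_def)
  have "gramian (diag_generator n w) T (vec n f) = of_real (T / n) \<cdot>\<^sub>m 1\<^sub>m n"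
    unfolding gramian_eq_scalar_iff[OF assms] using mod ex by blast
  then have "lambda_min (gramian (diag_generator n w) T (vec n f)) = T / n"
    using lambda_min_gramian(2)[OF f f less_imp_le[OF T] n] by blast
  then have "T / n \<in> scalar_values (diag_generator n w) T"
    unfolding scalar_values_def dim_diag_generator unit_profiles_eq using f by (metis image_eqI)
  then have "T / n \<le> scalar_value (diag_generator n w) T"
    using scalar_value_greatest(2) T n by simp
  moreover have "scalar_value (diag_generator n w) T \<le> T / n"
    using scalar_value_greatest(1)[of T n w] T n lambda_min_gramian(1)[OF _ _ less_imp_le[OF T] n]
    by (auto simp: scalar_values_def unit_profiles_eq)
  ultimately show "scalar_recovery_exact (diag_generator n w) T"
    using T n by (simp add: scalar_recovery_exact_def relaxed_value_eq)
qed

text \<open>At an exact horizon the phase condition already holds, so reaching \<open>T / n\<close>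
  is a condition on the moduli alone.\<close>

lemma maximizing_profiles_eq:
  assumes T: "T > 0" and n: "n > 0" and w: "inj_on w {..<n}"
    and exact: "scalar_recovery_exact (diag_generator n w) T"
  shows "maximizing_profiles (diag_generator n w) T
      = {b \<in> carrier_vec n. \<forall>i<n. (cmod (vec_index b i))\<^sup>2 = 1 / n}"
    and "b \<in> maximizing_profiles (diag_generator n w) T \<Longrightarrow>
      gramian (diag_generator n w) T b = of_real (T / n) \<cdot>\<^sub>m 1\<^sub>m n"
proof -
  have val: "scalar_value (diag_generator n w) T = T / n"
    using T n exact by (simp add: scalar_recovery_exact_def relaxed_value_eq)
  note ex = exact[unfolded scalar_recovery_iff[OF T n w]]
  have iff: "lambda_min (gramian (diag_generator n w) T (vec n f)) = T / n \<longleftrightarrow>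
      (\<forall>i<n. (cmod (f i))\<^sup>2 = 1 / n)" if "f \<in> unit_csphere n" for f
    using lambda_min_gramian(2)[OF that that less_imp_le[OF T] n, of w]
      gramian_eq_scalar_iff[OF T n w, of f] ex by blast
  have mem: "b \<in> maximizing_profiles (diag_generator n w) T \<longleftrightarrow>
      b \<in> carrier_vec n \<and> (\<forall>i<n. (cmod (vec_index b i))\<^sup>2 = 1 / n)" for b
  proof
    assume "b \<in> maximizing_profiles (diag_generator n w) T"
    then obtain f where f: "f \<in> unit_csphere n" "b = vec n f"
      and "lambda_min (gramian (diag_generator n w) T b) = T / n"
      by (auto simp: maximizing_profiles_def unit_profiles_eq val)
    with iff[OF f(1)] show "b \<in> carrier_vec n \<and> (\<forall>i<n. (cmod (vec_index b i))\<^sup>2 = 1 / n)"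
      by simp
  next
    assume b: "b \<in> carrier_vec n \<and> (\<forall>i<n. (cmod (vec_index b i))\<^sup>2 = 1 / n)"
    define f where "f = (\<lambda>i. if i < n then vec_index b i else 0)"
    have bf: "b = vec n f"
      using b by (auto simp: f_def)
    have mod: "\<forall>i<n. (cmod (f i))\<^sup>2 = 1 / n"
      using b by (simp add: f_def)
    \<comment> \<open>The \<open>n\<close> squared moduli \<open>1 / n\<close> sum to one, so the
      prescribed moduli imply unit norm.\<close>
    then have f: "f \<in> unit_csphere n"
      using n by (simp add: unit_csphere_def f_def)
    from iff[OF f] mod have "lambda_min (gramian (diag_generator n w) T b) = T / n"
      by (simp add: bf)
    with f show "b \<in> maximizing_profiles (diag_generator n w) T"
      by (auto simp: maximizing_profiles_def unit_profiles_eq val bf)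
  qed
  then show "maximizing_profiles (diag_generator n w) T
      = {b \<in> carrier_vec n. \<forall>i<n. (cmod (vec_index b i))\<^sup>2 = 1 / n}"
    by blast
  show "gramian (diag_generator n w) T b = of_real (T / n) \<cdot>\<^sub>m 1\<^sub>m n"
    if b: "b \<in> maximizing_profiles (diag_generator n w) T"
  proof -
    define f where "f = (\<lambda>i. vec_index b i)"
    have "b = vec n f" "\<forall>i<n. (cmod (f i))\<^sup>2 = 1 / n"
      using b unfolding mem by (auto simp: f_def)
    then show ?thesis
      using gramian_eq_scalar_iff[OF T n w, of f] ex by blast
  qed
qed

section \<open>Arithmetic of the recovery horizons\<close>

lemma exp_square_phase_eq_iff:
  "exp (- \<i> * (of_nat j)\<^sup>2 * complex_of_real T) = exp (- \<i> * (of_nat k)\<^sup>2 * complex_of_real T)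
    \<longleftrightarrow> (\<exists>m :: int. ((real k)\<^sup>2 - (real j)\<^sup>2) * T = 2 * pi * m)"
proof -
  \<comment> \<open>By \<open>exp_eq\<close> the exponents must differ by an integer multiple of
    \<open>2 * pi * \<i>\<close>; comparing imaginary parts gives a real condition.\<close>
  have "- \<i> * (of_nat j)\<^sup>2 * complex_of_real T
      = - \<i> * (of_nat k)\<^sup>2 * complex_of_real T + complex_of_real (real_of_int (2 * m) * pi) * \<i>
    \<longleftrightarrow> ((real k)\<^sup>2 - (real j)\<^sup>2) * T = 2 * pi * m" for m :: int
    by (auto simp: complex_eq_iff algebra_simps power2_eq_square)
  then show ?thesis
    unfolding exp_eq by simp
qed

text \<open>Up to sign the only nonzero gap of squares is \<open>4 - 1 = 3\<close>, which produces
  the spacing \<open>2 * pi / 3\<close>.\<close>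

lemma all_square_phases_eq_2:
  assumes "T > 0"
  shows "(\<forall>j\<in>{1..2}. \<forall>k\<in>{1..2}. \<exists>m :: int. ((real k)\<^sup>2 - (real j)\<^sup>2) * T = 2 * pi * m)
    \<longleftrightarrow> (\<exists>m\<ge>1. T = 2 * pi / 3 * real m)"
proof
  assume phases: "\<forall>j\<in>{1..2}. \<forall>k\<in>{1..2}. \<exists>m :: int. ((real k)\<^sup>2 - (real j)\<^sup>2) * T = 2 * pi * m"
  have "\<exists>m :: int. ((real 2)\<^sup>2 - (real 1)\<^sup>2) * T = 2 * pi * m"
    by (intro phases[rule_format]) auto
  then obtain m :: int where m: "3 * T = 2 * pi * m"
    by auto
  with assms have "0 < 2 * pi * m"
    by linarith
  then have "m > 0"
    by (simp add: zero_less_mult_iff)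
  with m show "\<exists>m\<ge>1. T = 2 * pi / 3 * real m"
    by (intro exI[of _ "nat m"]) auto
next
  assume "\<exists>m\<ge>1. T = 2 * pi / 3 * real m"
  then obtain m :: nat where m: "T = 2 * pi / 3 * real m"
    by blast
  show "\<forall>j\<in>{1..2}. \<forall>k\<in>{1..2}. \<exists>m :: int. ((real k)\<^sup>2 - (real j)\<^sup>2) * T = 2 * pi * m"
  proof (intro ballI)
    fix j k :: nat assume "j \<in> {1..2}" "k \<in> {1..2}"
    then consider "j = k" | "j = 1" "k = 2" | "j = 2" "k = 1"
      by force
    then show "\<exists>m :: int. ((real k)\<^sup>2 - (real j)\<^sup>2) * T = 2 * pi * m"
    proof cases
      case 1
      then show ?thesis by (intro exI[of _ 0]) simp
    next
      case 2
      then show ?thesis by (intro exI[of _ "int m"]) (simp add: m)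
    next
      case 3
      then show ?thesis by (intro exI[of _ "- int m"]) (simp add: m)
    qed
  qed
qed

text \<open>With three modes both gaps 3 and 5 occur, and \<open>1 = 2 * 3 - 5\<close>.\<close>

lemma all_square_phases_eq_ge_3:
  assumes "T > 0" "N \<ge> 3"
  shows "(\<forall>j\<in>{1..N}. \<forall>k\<in>{1..N}. \<exists>m :: int. ((real k)\<^sup>2 - (real j)\<^sup>2) * T = 2 * pi * m)
    \<longleftrightarrow> (\<exists>m\<ge>1. T = 2 * pi * real m)"
proof
  assume phases: "\<forall>j\<in>{1..N}. \<forall>k\<in>{1..N}. \<exists>m :: int. ((real k)\<^sup>2 - (real j)\<^sup>2) * T = 2 * pi * m"
  have "\<exists>m :: int. ((real 2)\<^sup>2 - (real 1)\<^sup>2) * T = 2 * pi * m"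
    by (intro phases[rule_format]) (use assms in auto)
  then obtain m :: int where m: "3 * T = 2 * pi * m"
    by auto
  have "\<exists>m :: int. ((real 3)\<^sup>2 - (real 2)\<^sup>2) * T = 2 * pi * m"
    by (intro phases[rule_format]) (use assms in auto)
  then obtain l :: int where l: "5 * T = 2 * pi * l"
    by auto
  have T: "T = 2 * pi * (2 * m - l)"
    using m l by (simp add: algebra_simps)
  with assms have "0 < 2 * pi * (2 * m - l)"
    by linarith
  then have "0 < 2 * real_of_int m - l"
    by (simp add: zero_less_mult_iff)
  then have "2 * m - l > 0"
    by linarith
  with T show "\<exists>m\<ge>1. T = 2 * pi * real m"
    by (intro exI[of _ "nat (2 * m - l)"]) auto
next
  assume "\<exists>m\<ge>1. T = 2 * pi * real m"
  then obtain m :: nat where m: "T = 2 * pi * real m"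
    by blast
  show "\<forall>j\<in>{1..N}. \<forall>k\<in>{1..N}. \<exists>m :: int. ((real k)\<^sup>2 - (real j)\<^sup>2) * T = 2 * pi * m"
  proof (intro ballI)
    fix j k :: nat
    show "\<exists>m :: int. ((real k)\<^sup>2 - (real j)\<^sup>2) * T = 2 * pi * m"
      \<comment> \<open>Every gap of squares is an integer, so one \<open>m\<close> serves all pairs
        of modes.\<close>
      by (intro exI[of _ "((int k)\<^sup>2 - (int j)\<^sup>2) * int m"]) (simp add: m)
  qed
qed

text \<open>Membership reduces to convergence of the series of \<open>j powr (- 2 * s)\<close>,
  whose threshold is \<open>- 2 * s < - 1\<close>.\<close>

lemma unimodular_HD_neg_iff:
  assumes "\<And>j. j \<ge> 1 \<Longrightarrow> cmod (b j) = 1"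
  shows "b \<in> HD_neg s \<longleftrightarrow> s > 1 / 2"
proof -
  let ?f = "\<lambda>j. real j powr (- 2 * s)"
  have "b \<in> HD_neg s \<longleftrightarrow> ?f summable_on {1..}"
    unfolding HD_neg_def mem_Collect_eq using assms by (intro summable_on_cong) simp
  \<comment> \<open>Adding the index 0 is harmless because \<open>0 powr x = 0\<close>.\<close>
  also have "\<dots> \<longleftrightarrow> ?f summable_on UNIV"
    by (rule summable_on_cong_neutral) (auto simp: not_le)
  also have "\<dots> \<longleftrightarrow> summable ?f"
    by (rule summable_on_UNIV_nonneg_real_iff) simp
  also have "\<dots> \<longleftrightarrow> s > 1 / 2"
    by (subst summable_real_powr_iff) auto
  finally show ?thesis .
qed

section \<open>The Schroedinger generator and its modes\<close>

lemma ball_modes_iff: "(\<forall>j\<in>{1..N}. P j) \<longleftrightarrow> (\<forall>i<N. P (Suc i))"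
  unfolding image_Suc_lessThan[symmetric] by blast

lemma schroedinger_mat_eq: "schroedinger_mat N = diag_generator N (\<lambda>i. (real (Suc i))\<^sup>2)"
  by (simp add: schroedinger_mat_def diag_generator_def)

theorem proposition5p2:
  fixes N :: nat
  assumes "N \<ge> 1"
  shows
    "(\<forall>T>0. has_max (scalar_values (schroedinger_mat N) T)
          \<and> has_max (relaxed_values (schroedinger_mat N) T)
          \<and> (scalar_recovery_exact (schroedinger_mat N) T \<longleftrightarrow>
               (\<forall>j\<in>{1..N}. \<forall>k\<in>{1..N}.
                  exp (- \<i> * (of_nat j)\<^sup>2 * complex_of_real T)
                    = exp (- \<i> * (of_nat k)\<^sup>2 * complex_of_real T))))
     \<and> (N = 1 \<longrightarrow> recovery_horizons (schroedinger_mat N) = {0<..})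
     \<and> (N = 2 \<longrightarrow> recovery_horizons (schroedinger_mat N) = {2 * pi / 3 * real m | m. m \<ge> 1})
     \<and> (N \<ge> 3 \<longrightarrow> recovery_horizons (schroedinger_mat N) = {2 * pi * real m | m. m \<ge> 1})
     \<and> (\<forall>T \<in> recovery_horizons (schroedinger_mat N).
          maximizing_profiles (schroedinger_mat N) T
            = {b \<in> carrier_vec N. \<forall>j\<in>{1..N}. (cmod (b $ (j - 1)))\<^sup>2 = 1 / real N}
        \<and> (\<forall>b \<in> maximizing_profiles (schroedinger_mat N) T.
             gramian (schroedinger_mat N) T b = complex_of_real (T / real N) \<cdot>\<^sub>m 1\<^sub>m N
           \<and> (\<forall>j\<in>{1..N}. cmod ((complex_of_real (sqrt (real N)) \<cdot>\<^sub>v b) $ (j - 1)) = 1)))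
     \<and> (\<forall>b :: nat \<Rightarrow> complex. (\<forall>j\<ge>1. cmod (b j) = 1) \<longrightarrow>
          (\<forall>s :: real. b \<in> HD_neg s \<longleftrightarrow> s > 1 / 2))"
proof -
  let ?A = "schroedinger_mat N"
  define w where "w = (\<lambda>i. (real (Suc i))\<^sup>2)"
  have A: "?A = diag_generator N w"
    unfolding w_def by (rule schroedinger_mat_eq)
  have N: "N > 0"
    using assms by simp
  \<comment> \<open>Squaring is injective on the positive mode numbers, so the frequencies are
    distinct.\<close>
  have inj: "inj_on w {..<N}"
    by (auto simp: inj_on_def w_def)
  have exact: "scalar_recovery_exact ?A T \<longleftrightarrow>
      (\<forall>j\<in>{1..N}. \<forall>k\<in>{1..N}. exp (- \<i> * (of_nat j)\<^sup>2 * complex_of_real T)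
        = exp (- \<i> * (of_nat k)\<^sup>2 * complex_of_real T))" if "T > 0" for T
    unfolding A scalar_recovery_iff[OF that N inj] ball_modes_iff
    by (simp add: w_def mult.assoc)
  have horizon: "T \<in> recovery_horizons ?A \<longleftrightarrow> T > 0 \<and>
      (\<forall>j\<in>{1..N}. \<forall>k\<in>{1..N}. \<exists>m :: int. ((real k)\<^sup>2 - (real j)\<^sup>2) * T = 2 * pi * m)" for T
    unfolding recovery_horizons_def using exact[of T] exp_square_phase_eq_iff by auto
  have has_max: "has_max (scalar_values ?A T)" "has_max (relaxed_values ?A T)" if "T > 0" for T
    using that N by (simp_all add: A has_max_scalar_values has_max_relaxed_values)
  have one: "recovery_horizons ?A = {0<..}" if "N = 1"
  proof (intro equalityI subsetI)
    fix T :: real assume "T \<in> {0<..}"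
    \<comment> \<open>Only \<open>j = k = 1\<close> occurs, with gap zero.\<close>
    moreover have "\<forall>j\<in>{1..N}. \<forall>k\<in>{1..N}. \<exists>m :: int. ((real k)\<^sup>2 - (real j)\<^sup>2) * T = 2 * pi * m"
      using that by (auto intro!: exI[of _ 0])
    ultimately show "T \<in> recovery_horizons ?A"
      by (simp add: horizon)
  qed (simp add: horizon)
  have two: "recovery_horizons ?A = {2 * pi / 3 * real m | m. m \<ge> 1}" if "N = 2"
  proof -
    have "T \<in> recovery_horizons ?A \<longleftrightarrow> T > 0 \<and> (\<exists>m\<ge>1. T = 2 * pi / 3 * real m)" for T
      \<comment> \<open>\<open>horizon\<close> is stated for \<open>N\<close>, so it is unfolded
        before \<open>N\<close> is replaced by 2.\<close>
      unfolding horizon unfolding that using all_square_phases_eq_2[of T] by blast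
    moreover have "2 * pi / 3 * real m > 0" if "m \<ge> 1" for m
      using that by simp
    ultimately show ?thesis by blast
  qed
  have three: "recovery_horizons ?A = {2 * pi * real m | m. m \<ge> 1}" if "N \<ge> 3"
  proof -
    have "T \<in> recovery_horizons ?A \<longleftrightarrow> T > 0 \<and> (\<exists>m\<ge>1. T = 2 * pi * real m)" for T
      unfolding horizon using all_square_phases_eq_ge_3[of T N] that by blast
    moreover have "2 * pi * real m > 0" if "m \<ge> 1" for m
      using that by simp
    ultimately show ?thesis by blast
  qed
  have profiles: "maximizing_profiles ?A T
        = {b \<in> carrier_vec N. \<forall>j\<in>{1..N}. (cmod (b $ (j - 1)))\<^sup>2 = 1 / real N}
      \<and> (\<forall>b \<in> maximizing_profiles ?A T.
           gramian ?A T b = complex_of_real (T / real N) \<cdot>\<^sub>m 1\<^sub>m N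
         \<and> (\<forall>j\<in>{1..N}. cmod ((complex_of_real (sqrt (real N)) \<cdot>\<^sub>v b) $ (j - 1)) = 1))"
    if "T \<in> recovery_horizons ?A" for T
  proof -
    have T: "T > 0" "scalar_recovery_exact (diag_generator N w) T"
      using that by (auto simp: recovery_horizons_def A)
    note max = maximizing_profiles_eq[OF T(1) N inj T(2)]
    have "cmod ((complex_of_real (sqrt (real N)) \<cdot>\<^sub>v b) $ i) = 1"
      if "b \<in> maximizing_profiles (diag_generator N w) T" "i < N" for b i
    proof -
      have b: "b \<in> carrier_vec N" "(cmod (b $ i))\<^sup>2 = 1 / real N"
        using that unfolding max(1) by auto
      have "(cmod ((complex_of_real (sqrt (real N)) \<cdot>\<^sub>v b) $ i))\<^sup>2 = real N * (cmod (b $ i))\<^sup>2"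
        using b that by (simp add: norm_mult power_mult_distrib)
      also have "\<dots> = 1"
        using N by (simp add: b)
      finally show ?thesis
        by (simp add: power2_eq_1_iff) (smt (verit) norm_ge_zero)
    qed
    \<comment> \<open>After \<open>ball_modes_iff\<close> the mode \<open>j\<close> is
      \<open>Suc i\<close>, and the index \<open>j - 1\<close> becomes \<open>i\<close>.\<close>
    with max show ?thesis
      unfolding A ball_modes_iff by simp
  qed
  show ?thesis
  proof (intro conjI, goal_cases)
    case 1
    show ?case using has_max exact by (intro allI impI conjI)
  next
    case 2
    show ?case using one by (rule impI)
  next
    case 3
    show ?case using two by (rule impI)
  next
    case 4
    show ?case using three by (rule impI)
  next
    case 5
    show ?case using profiles by (rule ballI)
  next
    case 6
    show ?case using unimodular_HD_neg_iff by (intro allI impI) simp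
  qed
qed

end
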